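(* Let $\mathcal{B}(x)=\Gamma(x)^2/\Gamma(2x)$ for $x>0$. The following statements are valid. (i) The expansions $$\mathcal{B}(x)=2^{1-2x}\sum_{n=0}^{\infty}\frac{W_n}{x+n}=2\sum_{n=0}^{\infty}\frac{(1-x)_n}{(x+n+1)\,n!}$$ hold for $x>0$. (ii) The function $\mathcal{B}$ is completely monotonic on $(0,\infty)$. Moreover, for every integer $n\ge 0$, the function $$x\mapsto 2^{2x-1}\mathcal{B}(x)-\sum_{k=0}^{n}\frac{W_k}{x+k}$$ is completely monotonic on $(0,\infty)$, while the function $$x\mapsto \mathcal{B}(x)-2\sum_{k=0}^{n}\frac{(1-x)_k}{(x+k+1)\,k!}$$ is completely monotonic on $(0,1)$. (iii) For $x\in(0,1)$, the function $\mathcal{B}(x)$ has the power series representation $$\mathcal{B}(x)=\frac{2}{x}\sum_{k=0}^{\infty}a_kx^k,$$ where $a_0=1$ and, for $k\ge 1$, $$a_k=(-1)^k\left[\frac{(\ln 4)^k}{k!}-\sum_{j=0}^{k-1}\left(\sum_{n=1}^{\infty}\frac{W_n}{n^{k-j}}\right)\frac{(\ln 4)^j}{j!}\right].$$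
   Context: $\Gamma$ is the gamma function. For an integer $n\ge 0$, the Wallis ratio is $W_n=\frac{(2n-1)!!}{(2n)!!}=\frac{(1/2)_n}{n!}=\frac{\Gamma(n+1/2)}{\Gamma(1/2)\Gamma(n+1)}$ (so $W_0=1$). The Pochhammer symbol is $(a)_0=1$ and $(a)_n=a(a+1)\cdots(a+n-1)$ for $n\ge1$. A function $f$ is completely monotonic on an interval $I$ if it has derivatives of all orders on $I$ and $(-1)^m f^{(m)}(x)\ge 0$ for all $x\in I$ and all integers $m\ge 0$. *)

theory Defs
  imports "HOL-Analysis.Analysis"
begin

definition wallis :: "nat \<Rightarrow> real" where
  "wallis n = pochhammer (1/2) n / fact n"

lemma wallis_double_factorial:
  "wallis n = (\<Prod>k=1..n. 2 * real k - 1) / (\<Prod>k=1..n. 2 * real k)"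
proof (induction n)
  case 0
  show ?case by (simp add: wallis_def)
next
  case (Suc n)
  have "wallis (Suc n) = wallis n * ((2 * real (Suc n) - 1) / (2 * real (Suc n)))"
    by (simp add: wallis_def pochhammer_Suc divide_simps)
  then show ?case
    by (simp add: Suc.IH)
qed

lemma wallis_Gamma:
  "wallis n = Gamma (real n + 1/2) / (Gamma (1/2) * Gamma (real n + 1))"
proof -
  have "pochhammer (1/2 :: real) n = Gamma (1/2 + real n) / Gamma (1/2)"
    by (rule pochhammer_Gamma) (auto elim!: nonpos_Ints_cases)
  then show ?thesis
    by (simp add: wallis_def Gamma_fact [symmetric] add.commute)
qed

(* D m is the m-th derivative of f on I; at an end point belonging to I it is the
   one-sided derivative.  I is meant to be an interval with more than one point, where
   the functions D m are uniquely determined on I. *)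
definition completely_monotonic_on :: "real set \<Rightarrow> (real \<Rightarrow> real) \<Rightarrow> bool" where
  "completely_monotonic_on I f \<longleftrightarrow>
     (\<exists>D :: nat \<Rightarrow> real \<Rightarrow> real.
        (\<forall>x\<in>I. D 0 x = f x) \<and>
        (\<forall>m. \<forall>x\<in>I. (D m has_real_derivative D (Suc m) x) (at x within I)) \<and>
        (\<forall>m. \<forall>x\<in>I. (-1) ^ m * D m x \<ge> 0))"

definition central_beta :: "real \<Rightarrow> real" where
  "central_beta x = Gamma x ^ 2 / Gamma (2 * x)"

(* The sum over n \<ge> 1 of W_n / n^p. *)
definition wallis_zeta :: "nat \<Rightarrow> real" where
  "wallis_zeta p = (\<Sum>n. wallis (Suc n) / real (Suc n) ^ p)"

definition central_beta_coeff :: "nat \<Rightarrow> real" where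
  "central_beta_coeff k =
     (if k = 0 then 1
      else (-1) ^ k * (ln 4 ^ k / fact k - (\<Sum>j<k. wallis_zeta (k - j) * (ln 4 ^ j / fact j))))"

end

theory Submission
  imports Defs
begin

text \<open>
  Expanding \<open>(1 - t) powr (b - 1)\<close> in Euler's integral gives
  \<open>Beta a b = (\<Sum>n. pochhammer (1 - b) n / (n! * (a + n)))\<close>. Both expansions of \<open>central_beta\<close> are
  instances: Legendre duplication turns it into \<open>2 powr (1 - 2 * x) * Beta x (1/2)\<close>, and it
  also equals \<open>2 * Beta (x + 1) x\<close>. The terms of the two series are completely monotonic on
  \<open>(0,\<infinity>)\<close> and \<open>(0,1)\<close>, respectively, and a pointwise convergent series of completely monotonic
  functions is completely monotonic: Taylor expansion to the left bounds the \<open>m\<close>-th derivative at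
  \<open>x\<close> by \<open>m! / h ^ m\<close> times the value at \<open>x - h\<close>, so the series can be differentiated termwise.
  The power series is the Cauchy product of \<open>exp (- x * ln 4)\<close> with the expansion of the first
  series in powers of \<open>x\<close>, where the error after \<open>J\<close> terms is at most \<open>x ^ J\<close> times a constant.
\<close>

section \<open>Completely monotonic functions\<close>

text \<open>Derivatives are taken at \<open>x\<close> itself rather than within \<open>I\<close>.
  This is the stronger condition, and it is what the differentiation rules deliver.\<close>

lemma completely_monotonic_onI:
  assumes "\<And>x. x \<in> I \<Longrightarrow> D 0 x = f x"
    and "\<And>m x. x \<in> I \<Longrightarrow> (D m has_real_derivative D (Suc m) x) (at x)"
    and "\<And>m x. x \<in> I \<Longrightarrow> (-1) ^ m * D m x \<ge> 0"
  shows "completely_monotonic_on I f"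
  unfolding completely_monotonic_on_def
  using assms by (blast intro: has_field_derivative_at_within)

text \<open>On an open set the derivative within \<open>I\<close> is the ordinary two-sided
  one.\<close>

lemma completely_monotonic_onE:
  assumes "completely_monotonic_on I f" "open I"
  obtains D where "\<And>x. x \<in> I \<Longrightarrow> D 0 x = f x"
    and "\<And>m x. x \<in> I \<Longrightarrow> (D m has_real_derivative D (Suc m) x) (at x)"
    and "\<And>m x. x \<in> I \<Longrightarrow> (-1) ^ m * D m x \<ge> (0::real)"
proof -
  from assms(1) obtain D where D: "\<forall>x\<in>I. D 0 x = f x"
      "\<forall>m. \<forall>x\<in>I. (D m has_real_derivative D (Suc m) x) (at x within I)"
      "\<forall>m. \<forall>x\<in>I. (-1) ^ m * D m x \<ge> 0"
    unfolding completely_monotonic_on_def by blast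
  show thesis
    by (rule that[of D]) (use D at_within_open[OF _ assms(2)] in auto)
qed

lemma completely_monotonic_on_cong:
  assumes "\<And>x. x \<in> I \<Longrightarrow> f x = g x"
  shows "completely_monotonic_on I f \<longleftrightarrow> completely_monotonic_on I g"
  unfolding completely_monotonic_on_def using assms by simp

lemma completely_monotonic_on_const:
  "0 \<le> c \<Longrightarrow> completely_monotonic_on I (\<lambda>_. c)"
  by (rule completely_monotonic_onI[where D = "\<lambda>m x. if m = 0 then c else 0"])
     (auto intro!: derivative_eq_intros)

lemma completely_monotonic_on_inverse_shift:
  assumes "\<And>x. x \<in> I \<Longrightarrow> 0 < x + c"
  shows "completely_monotonic_on I (\<lambda>x. 1 / (x + c))"
proof (rule completely_monotonic_onI[where D = "\<lambda>m x. (-1) ^ m * fact m / (x + c) ^ Suc m"])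
  fix m :: nat and x assume "x \<in> I"
  then have pos: "0 < x + c" by (rule assms)
  show "((\<lambda>x. (-1) ^ m * fact m / (x + c) ^ Suc m) has_real_derivative
          (-1) ^ Suc m * fact (Suc m) / (x + c) ^ Suc (Suc m)) (at x)"
  proof (rule DERIV_cong)
    show "((\<lambda>x. (-1) ^ m * fact m / (x + c) ^ Suc m) has_real_derivative
        - ((-1) ^ m * fact m * (real (Suc m) * (x + c) ^ m)) / ((x + c) ^ Suc m * (x + c) ^ Suc m))
        (at x)"
      using pos by (auto intro!: derivative_eq_intros simp del: power_Suc)
    \<comment> \<open>Naming the sum \<open>x + c\<close> keeps it atomic, so that
      \<open>field_simps\<close> does not expand its powers.\<close>
    define y where "y = x + c"
    have "- ((-1) ^ m * fact m * (real (Suc m) * y ^ m)) / (y ^ Suc m * y ^ Suc m) =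
        (-1) ^ Suc m * fact (Suc m) / y ^ Suc (Suc m)"
    proof -
      have "y \<noteq> 0" using pos by (simp add: y_def)
      then show ?thesis by (simp add: field_simps)
    qed
    then show "- ((-1) ^ m * fact m * (real (Suc m) * (x + c) ^ m)) / ((x + c) ^ Suc m * (x + c) ^ Suc m) =
        (-1) ^ Suc m * fact (Suc m) / (x + c) ^ Suc (Suc m)"
      by (simp only: y_def)
  qed
  have "(-1) ^ m * ((-1) ^ m * fact m / (x + c) ^ Suc m) = fact m / (x + c) ^ Suc m"
    by (simp flip: power_mult_distrib mult.assoc)
  then show "0 \<le> (-1) ^ m * ((-1) ^ m * fact m / (x + c) ^ Suc m)"
    using pos by simp
qed simp

lemma completely_monotonic_on_exp:
  assumes "0 \<le> c"
  shows "completely_monotonic_on I (\<lambda>x. exp (- c * x))"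
proof (rule completely_monotonic_onI[where D = "\<lambda>m x. (- c) ^ m * exp (- c * x)"])
  fix m :: nat and x
  have "(-1) ^ m * ((- c) ^ m * exp (- c * x)) = c ^ m * exp (- c * x)"
    by (simp only: mult.assoc[symmetric] power_mult_distrib[symmetric]) simp
  then show "0 \<le> (-1) ^ m * ((- c) ^ m * exp (- c * x))"
    using assms by (simp only: zero_le_mult_iff zero_le_power exp_ge_zero simp_thms)
qed (auto intro!: derivative_eq_intros)

text \<open>Supplies the linear factors of \<open>pochhammer (1 - x) n\<close>.\<close>

lemma completely_monotonic_on_minus:
  assumes "\<And>x. x \<in> I \<Longrightarrow> x \<le> c"
  shows "completely_monotonic_on I (\<lambda>x. c - x)"
  by (rule completely_monotonic_onI[where D = "\<lambda>m x. if m = 0 then c - x else if m = 1 then - 1 else 0"])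
     (use assms in \<open>auto intro!: derivative_eq_intros\<close>)

text \<open>The induction step of the Leibniz rule, obtained from Pascal's rule after an index
  shift. \<open>A i j\<close> stands for the product of the \<open>i\<close>-th derivative of one
  factor and the \<open>j\<close>-th derivative of the other.\<close>

lemma sum_choose_Suc:
  fixes A :: "nat \<Rightarrow> nat \<Rightarrow> 'a::comm_semiring_1"
  shows "(\<Sum>i\<le>m. of_nat (m choose i) * (A (Suc i) (m - i) + A i (Suc (m - i)))) =
         (\<Sum>i\<le>Suc m. of_nat (Suc m choose i) * A i (Suc m - i))"
proof -
  \<comment> \<open>The summand with index \<open>Suc m\<close> vanishes; adding it makes room for
    splitting off index 0.\<close>
  have eq: "(\<Sum>i\<le>m. of_nat (m choose i) * A i (Suc m - i)) =
      (\<Sum>i\<le>m. of_nat (m choose Suc i) * A (Suc i) (m - i)) + A 0 (Suc m)"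
  proof -
    have "(\<Sum>i\<le>m. of_nat (m choose i) * A i (Suc m - i)) =
          (\<Sum>i\<le>Suc m. of_nat (m choose i) * A i (Suc m - i))"
      by (simp add: binomial_eq_0)
    also have "\<dots> = (\<Sum>i\<le>m. of_nat (m choose Suc i) * A (Suc i) (m - i)) + A 0 (Suc m)"
      by (subst sum.atMost_Suc_shift) (simp add: add.commute)
    finally show ?thesis .
  qed
  have "(\<Sum>i\<le>Suc m. of_nat (Suc m choose i) * A i (Suc m - i)) =
      (\<Sum>i\<le>m. of_nat (Suc m choose Suc i) * A (Suc i) (m - i)) + A 0 (Suc m)"
    by (subst sum.atMost_Suc_shift) (simp add: add.commute)
  also have "\<dots> = (\<Sum>i\<le>m. of_nat (m choose i) * A (Suc i) (m - i)) +
      ((\<Sum>i\<le>m. of_nat (m choose Suc i) * A (Suc i) (m - i)) + A 0 (Suc m))"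
    by (simp add: distrib_right sum.distrib add.assoc)
  also have "\<dots> = (\<Sum>i\<le>m. of_nat (m choose i) * A (Suc i) (m - i)) +
      (\<Sum>i\<le>m. of_nat (m choose i) * A i (Suc m - i))"
    by (simp only: eq)
  also have "\<dots> = (\<Sum>i\<le>m. of_nat (m choose i) * (A (Suc i) (m - i) + A i (Suc (m - i))))"
    by (simp add: distrib_left sum.distrib Suc_diff_le)
  finally show ?thesis ..
qed

text \<open>By the Leibniz rule: splitting \<open>(-1) ^ m\<close> as
  \<open>(-1) ^ i * (-1) ^ (m - i)\<close> gives each factor of a summand its own sign, so every
  summand is nonnegative.\<close>

lemma completely_monotonic_on_mult:
  assumes "completely_monotonic_on I f" "completely_monotonic_on I g" "open I"
  shows "completely_monotonic_on I (\<lambda>x. f x * g x)"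
proof -
  obtain F where F0: "\<And>x. x \<in> I \<Longrightarrow> F 0 x = f x"
    and F: "\<And>m x. x \<in> I \<Longrightarrow> (F m has_real_derivative F (Suc m) x) (at x)"
    and F_sgn: "\<And>m x. x \<in> I \<Longrightarrow> (-1) ^ m * F m x \<ge> 0"
    using completely_monotonic_onE[OF assms(1,3)] by metis
  obtain G where G0: "\<And>x. x \<in> I \<Longrightarrow> G 0 x = g x"
    and G: "\<And>m x. x \<in> I \<Longrightarrow> (G m has_real_derivative G (Suc m) x) (at x)"
    and G_sgn: "\<And>m x. x \<in> I \<Longrightarrow> (-1) ^ m * G m x \<ge> 0"
    using completely_monotonic_onE[OF assms(2,3)] by metis
  show ?thesis
  proof (rule completely_monotonic_onI[where
        D = "\<lambda>m x. \<Sum>i\<le>m. real (m choose i) * (F i x * G (m - i) x)"])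
    fix m x assume x: "x \<in> I"
    have "((\<lambda>x. \<Sum>i\<le>m. real (m choose i) * (F i x * G (m - i) x)) has_real_derivative
        (\<Sum>i\<le>m. real (m choose i) * (F (Suc i) x * G (m - i) x + F i x * G (Suc (m - i)) x))) (at x)"
      by (rule DERIV_sum, rule DERIV_cmult)
         (auto intro!: derivative_eq_intros F[OF x] G[OF x] simp: algebra_simps)
    then show "((\<lambda>x. \<Sum>i\<le>m. real (m choose i) * (F i x * G (m - i) x)) has_real_derivative
        (\<Sum>i\<le>Suc m. real (Suc m choose i) * (F i x * G (Suc m - i) x))) (at x)"
      unfolding sum_choose_Suc[of m "\<lambda>i j. F i x * G j x"] .
    have "(-1) ^ m * (\<Sum>i\<le>m. real (m choose i) * (F i x * G (m - i) x)) =
        (\<Sum>i\<le>m. real (m choose i) * (((-1) ^ i * F i x) * ((-1) ^ (m - i) * G (m - i) x)))"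
    proof (subst sum_distrib_left, rule sum.cong[OF refl])
      fix i assume "i \<in> {..m}"
      then have "(-1::real) ^ m = (-1) ^ i * (-1) ^ (m - i)"
        by (simp flip: power_add)
      then show "(-1) ^ m * (real (m choose i) * (F i x * G (m - i) x)) =
          real (m choose i) * (((-1) ^ i * F i x) * ((-1) ^ (m - i) * G (m - i) x))"
        by (simp only: ac_simps)
    qed
    also have "\<dots> \<ge> 0"
      by (intro sum_nonneg mult_nonneg_nonneg F_sgn G_sgn x) simp
    finally show "0 \<le> (-1) ^ m * (\<Sum>i\<le>m. real (m choose i) * (F i x * G (m - i) x))" .
  qed (simp add: F0 G0)
qed

text \<open>In the Taylor expansion of \<open>D 0\<close> at \<open>x\<close>, evaluated at \<open>x - h\<close>, every term is
  nonnegative, the remainder included.\<close>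
lemma completely_monotonic_derivative_bound:
  fixes D :: "nat \<Rightarrow> real \<Rightarrow> real"
  assumes deriv: "\<And>m t. t \<in> {x - h..x} \<Longrightarrow> (D m has_real_derivative D (Suc m) t) (at t)"
    and sgn: "\<And>m t. t \<in> {x - h..x} \<Longrightarrow> (-1) ^ m * D m t \<ge> 0"
    and h: "0 < h"
  shows "\<bar>D m x\<bar> \<le> fact m / h ^ m * D 0 (x - h)"
proof -
  \<comment> \<open>The alternating sign of the derivatives cancels the sign of
    \<open>(- h) ^ k\<close>.\<close>
  have eq: "D k t * (- h) ^ k = \<bar>D k t\<bar> * h ^ k" if "t \<in> {x - h..x}" for k t
  proof -
    have "\<bar>D k t\<bar> = \<bar>(-1) ^ k * D k t\<bar>" by (simp add: abs_mult)
    also have "\<dots> = (-1) ^ k * D k t" using sgn[OF that] by simp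
    finally show ?thesis by (simp add: power_minus[of h])
  qed
  have "\<exists>t. x - h < t \<and> t < x \<and> D 0 (x - h) =
      (\<Sum>k<Suc m. (D k x / fact k) * (x - h - x) ^ k) +
      (D (Suc m) t / fact (Suc m)) * (x - h - x) ^ Suc m"
    by (rule Taylor_down[where b = x]) (use deriv h in auto)
  then obtain t where t: "x - h < t" "t < x" and taylor: "D 0 (x - h) =
      (\<Sum>k<Suc m. (D k x * (- h) ^ k) / fact k) + (D (Suc m) t * (- h) ^ Suc m) / fact (Suc m)"
    by auto
  \<comment> \<open>A single Taylor term is at most the sum of all of them, since none is
    negative.\<close>
  have "\<bar>D m x\<bar> * h ^ m / fact m \<le> (\<Sum>k<Suc m. \<bar>D k x\<bar> * h ^ k / fact k)"
    using h by (intro member_le_sum) auto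
  also have "\<dots> \<le> (\<Sum>k<Suc m. \<bar>D k x\<bar> * h ^ k / fact k) + \<bar>D (Suc m) t\<bar> * h ^ Suc m / fact (Suc m)"
    using h by simp
  also have "\<dots> = D 0 (x - h)"
    unfolding taylor using t h by (subst (1 2) eq) auto
  finally show ?thesis using h by (simp add: field_simps)
qed

text \<open>The Taylor bound at \<open>x\<close> involves the value of a term at
  \<open>x - h\<close>. Because the terms are nonincreasing, this value may be replaced by the one
  at a fixed point further left. The bound is then uniform to the right of a point, and the
  Weierstrass test justifies differentiating termwise.\<close>

lemma completely_monotonic_on_suminf:
  fixes f :: "nat \<Rightarrow> real \<Rightarrow> real"
  assumes cm: "\<And>k. completely_monotonic_on I (f k)" and I: "open I" "convex I"
    and summ: "\<And>x. x \<in> I \<Longrightarrow> summable (\<lambda>k. f k x)"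
  shows "completely_monotonic_on I (\<lambda>x. \<Sum>k. f k x)"
proof -
  have "\<forall>k. \<exists>D. (\<forall>x\<in>I. D 0 x = f k x) \<and>
      (\<forall>m. \<forall>x\<in>I. (D m has_real_derivative D (Suc m) x) (at x)) \<and>
      (\<forall>m. \<forall>x\<in>I. (-1) ^ m * D m x \<ge> 0)"
    using cm completely_monotonic_onE[OF _ I(1)] by metis
  then obtain D where D0: "\<And>k x. x \<in> I \<Longrightarrow> D k 0 x = f k x"
    and D: "\<And>k m x. x \<in> I \<Longrightarrow> (D k m has_real_derivative D k (Suc m) x) (at x)"
    and sgn: "\<And>k m x. x \<in> I \<Longrightarrow> (-1) ^ m * D k m x \<ge> 0"
    by metis
  have left: "\<exists>h>0. x - h \<in> I" if x: "x \<in> I" for x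
  proof -
    obtain e where "e > 0" "ball x e \<subseteq> I" using I(1) x open_contains_ball by blast
    then show ?thesis by (intro exI[of _ "e/2"]) (auto simp: dist_real_def)
  qed
  have seg: "t \<in> I" if "a \<in> I" "b \<in> I" "a \<le> t" "t \<le> b" for a b t
    using I(2) that by (meson convex_contains_segment closed_segment_eq_real_ivl atLeastAtMost_iff
        order_trans in_mono is_interval_1 is_interval_convex_1)
  have anti: "f k y \<le> f k x" if "x \<in> I" "y \<in> I" "x \<le> y" for k x y
  proof -
    have "D k 0 y \<le> D k 0 x"
    proof (rule DERIV_nonpos_imp_nonincreasing[OF that(3)])
      fix t assume "x \<le> t" "t \<le> y"
      then have "t \<in> I" using seg that by blast
      then show "\<exists>l. (D k 0 has_real_derivative l) (at t) \<and> l \<le> 0"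
        using D[of t k 0] sgn[of t 1 k] by auto
    qed
    then show ?thesis using D0 that by simp
  qed
  \<comment> \<open>The right-hand side does not depend on \<open>x\<close>: \<open>a - h\<close>
    lies to the left of \<open>x - h\<close>, and \<open>f k\<close> is nonincreasing.\<close>
  have bound: "\<bar>D k m x\<bar> \<le> fact m / h ^ m * f k (a - h)"
    if h: "0 < h" and a: "a \<in> I" "a - h \<in> I" and x: "x \<in> I" "a \<le> x" for a h x k m
  proof -
    have mem: "x - h \<in> I" using seg[of "a - h" x "x - h"] that by simp
    have "\<bar>D k m x\<bar> \<le> fact m / h ^ m * D k 0 (x - h)"
    proof (rule completely_monotonic_derivative_bound[OF _ _ h])
      fix t assume "t \<in> {x - h..x}"
      then have "t \<in> I" using seg[OF mem x(1)] by simp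
      then show "(D k n has_real_derivative D k (Suc n) t) (at t)" "0 \<le> (- 1) ^ n * D k n t" for n
        using D sgn by auto
    qed
    also have "\<dots> \<le> fact m / h ^ m * f k (a - h)"
      using h D0[OF mem] anti[OF a(2) mem] x by (intro mult_left_mono) auto
    finally show ?thesis .
  qed
  have summ_D: "summable (\<lambda>k. D k m x)" if x: "x \<in> I" for m x
  proof -
    obtain h where h: "h > 0" "x - h \<in> I" using left x by blast
    show ?thesis
      by (rule summable_comparison_test'[OF summable_mult[OF summ[OF h(2)], of "fact m / h ^ m"]])
         (use bound[OF h(1) x h(2) x] in auto)
  qed
  show ?thesis
  proof (rule completely_monotonic_onI[where D = "\<lambda>m x. \<Sum>k. D k m x"])
    fix m x assume x: "x \<in> I"
    \<comment> \<open>Two moves to the left are made: \<open>a = x - d\<close> puts \<open>x\<close>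
      into the interior of \<open>?S\<close>, and \<open>a - h\<close> is the point where the
      majorant of the series is evaluated.\<close>
    obtain d where d: "d > 0" "x - d \<in> I" using left x by blast
    define a where "a = x - d"
    obtain h where h: "h > 0" "a - h \<in> I" using left[OF d(2)] by (auto simp: a_def)
    let ?S = "I \<inter> {a..}"
    show "((\<lambda>x. \<Sum>k. D k m x) has_real_derivative (\<Sum>k. D k (Suc m) x)) (at x)"
    proof (rule has_field_derivative_series'(2)[where S = ?S and x0 = x and f' = "\<lambda>k. D k (Suc m)"])
      show "convex ?S" using I(2) by (intro convex_Int) auto
      show "(D k m has_real_derivative D k (Suc m) y) (at y within ?S)" if "y \<in> ?S" for k y
        using D that by (blast intro: has_field_derivative_at_within)
      show "uniformly_convergent_on ?S (\<lambda>n y. \<Sum>i<n. D i (Suc m) y)"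
      proof (rule Weierstrass_m_test')
        show "summable (\<lambda>k. fact (Suc m) / h ^ Suc m * f k (a - h))"
          by (rule summable_mult[OF summ[OF h(2)]])
        show "norm (D k (Suc m) y) \<le> fact (Suc m) / h ^ Suc m * f k (a - h)" if "y \<in> ?S" for k y
          using bound[OF h(1) _ h(2), of y k "Suc m"] that d by (simp add: a_def)
      qed
      show "x \<in> ?S" using x d by (simp add: a_def)
      show "summable (\<lambda>k. D k m x)" by (rule summ_D[OF x])
      show "x \<in> interior ?S" using x d I(1) by (simp add: interior_open a_def)
    qed
    have "(-1) ^ m * (\<Sum>k. D k m x) = (\<Sum>k. (-1) ^ m * D k m x)"
      by (rule suminf_mult[OF summ_D[OF x], symmetric])
    also have "\<dots> \<ge> 0"
      by (rule suminf_nonneg[OF summable_mult[OF summ_D[OF x]]]) (use sgn x in auto)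
    finally show "0 \<le> (-1) ^ m * (\<Sum>k. D k m x)" .
  qed (simp add: D0)
qed

section \<open>The beta function as a series\<close>

text \<open>Gauss's product for the reciprocal Gamma function shows that
  \<open>pochhammer (1 - b) n / fact n\<close> is of order at most \<open>n powr (- b)\<close>, so
  the terms are dominated by a multiple of \<open>n powr (- 1 - b)\<close>.\<close>

lemma abs_summable_pochhammer_over_fact:
  fixes a b :: real
  assumes "0 < a" "0 < b"
  shows "summable (\<lambda>n. \<bar>pochhammer (1 - b) n / fact n\<bar> / (a + real n))"
proof -
  \<comment> \<open>The summand 1 puts the limit strictly below \<open>C\<close>, also when the
    limit is 0, that is, when \<open>b\<close> is a positive integer.\<close>
  define C where "C = \<bar>rGamma (1 - b)\<bar> + 1"
  have "(\<lambda>n. \<bar>rGamma_series (1 - b) n\<bar>) \<longlonglongrightarrow> \<bar>rGamma (1 - b)\<bar>"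
    by (intro tendsto_intros)
  then have ev: "eventually (\<lambda>n. \<bar>rGamma_series (1 - b) n\<bar> < C) sequentially"
    by (rule order_tendstoD) (simp add: C_def)
  have "eventually (\<lambda>n. norm (\<bar>pochhammer (1 - b) n / fact n\<bar> / (a + real n)) \<le>
      2 * C * real n powr (- 1 - b)) sequentially"
    \<comment> \<open>From \<open>n \<ge> 2 * b\<close> it follows that \<open>1 - b + n\<close> is
      at least \<open>n / 2\<close>; the added 1 excludes \<open>n = 0\<close>.\<close>
    using ev eventually_ge_at_top[of "nat \<lceil>2 * b\<rceil> + 1"]
  proof eventually_elim
    case (elim n)
    then have n: "real n \<ge> 2 * b" "real n > 0" by linarith+
    have "\<bar>pochhammer (1 - b) n\<bar> / fact n * (1 - b + real n) / real n powr (1 - b) =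
        \<bar>rGamma_series (1 - b) n\<bar>"
      using n assms
      by (simp add: rGamma_series_def pochhammer_Suc abs_mult powr_def abs_divide)
    then have "\<bar>pochhammer (1 - b) n\<bar> / fact n * (1 - b + real n) / real n powr (1 - b) \<le> C"
      using elim by simp
    then have "\<bar>pochhammer (1 - b) n\<bar> / fact n * (1 - b + real n) \<le> C * real n powr (1 - b)"
      using n by (simp add: pos_divide_le_eq mult_ac)
    moreover have "\<bar>pochhammer (1 - b) n\<bar> / fact n * (real n / 2) \<le>
        \<bar>pochhammer (1 - b) n\<bar> / fact n * (1 - b + real n)"
      using n by (intro mult_left_mono) auto
    ultimately have le: "\<bar>pochhammer (1 - b) n\<bar> / fact n * (real n / 2) \<le> C * real n powr (1 - b)"
      by linarith
    have "\<bar>pochhammer (1 - b) n\<bar> / fact n / (a + real n) \<le> \<bar>pochhammer (1 - b) n\<bar> / fact n / real n"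
      using n assms by (intro divide_left_mono) auto
    also have "\<dots> = \<bar>pochhammer (1 - b) n\<bar> / fact n * (real n / 2) * 2 / (real n)\<^sup>2"
      using n by (simp add: field_simps power2_eq_square)
    also have "\<dots> \<le> C * real n powr (1 - b) * 2 / (real n)\<^sup>2"
      using le by (intro divide_right_mono mult_right_mono) auto
    also have "\<dots> = 2 * C * (real n powr (1 - b) / real n powr 2)"
      using n by simp
    also have "real n powr (1 - b) / real n powr 2 = real n powr (- 1 - b)"
      by (subst powr_diff [symmetric]) (simp add: algebra_simps)
    finally show ?case using assms by (simp add: abs_divide)
  qed
  moreover have "summable (\<lambda>n. 2 * C * real n powr (- 1 - b))"
    using assms by (intro summable_mult) (simp add: summable_real_powr_iff)
  ultimately show ?thesis by (rule summable_comparison_test_ev)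
qed

text \<open>Expand \<open>(1 - t) powr (b - 1)\<close> in the integral for \<open>Beta a b\<close>. The factor
  \<open>(1 - t) powr 0\<close> is kept in the terms because \<open>0 powr _ = 0\<close> then makes the expansion
  hold at the end points as well.\<close>
lemma Beta_sums:
  fixes a b :: real
  assumes "0 < a" "0 < b"
  shows "(\<lambda>n. pochhammer (1 - b) n / fact n / (a + real n)) sums Beta a b"
proof -
  define c where "c n = pochhammer (1 - b) n / fact n" for n
  \<comment> \<open>Euler's integrand, extended by zero to the whole line.\<close>
  define e where "e p q t = indicator {0..1} t *\<^sub>R (t powr (p - 1) * (1 - t) powr (q - 1))"
    for p q t :: real
  have int_e: "integrable lborel (e p q)" and integral_e: "(\<integral>t. e p q t \<partial>lborel) = Beta p q"
    if "0 < p" "0 < q" for p q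
  proof -
    show "integrable lborel (e p q)"
      using integrable_Beta[OF that] by (simp add: set_integrable_def e_def[abs_def])
    have "(\<integral>t. e p q t \<partial>lborel) = (LINT t:{0..1}|lborel. t powr (p - 1) * (1 - t) powr (q - 1))"
      by (simp add: set_lebesgue_integral_def e_def)
    also have "\<dots> = Beta p q"
      using set_borel_integral_eq_integral(2)[OF integrable_Beta[OF that]]
        has_integral_Beta_real[OF that] by (simp add: integral_unique)
    finally show "(\<integral>t. e p q t \<partial>lborel) = Beta p q" .
  qed
  have e_nonneg: "0 \<le> e p q t" for p q t
    by (simp add: e_def)
  \<comment> \<open>The integral of the \<open>n\<close>-th power term, without its
    coefficient.\<close>
  have Beta_1: "Beta (a + real n) 1 = 1 / (a + real n)" for n
  proof -
    have pos: "0 < a + real n" using assms by simp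
    then have "a + real n \<notin> \<int>\<^sub>\<le>\<^sub>0" by (auto elim!: nonpos_Ints_cases)
    then show ?thesis
      using pos Gamma_plus1[of "a + real n"] by (simp add: Beta_def Gamma_eq_zero_iff)
  qed
  define f where "f n t = c n * e (a + real n) 1 t" for n t
  have summ_c: "summable (\<lambda>n. \<bar>c n\<bar> / (a + real n))"
    unfolding c_def by (rule abs_summable_pochhammer_over_fact[OF assms])
  have e_powr: "e (a + real n) 1 t = (if t \<in> {0<..<1} then t powr (a - 1) * t ^ n else 0)" for n t
  proof (cases "t \<in> {0<..<1}")
    case True
    then have "t powr (a + real n - 1) = t powr (a - 1) * t powr real n"
      by (simp flip: powr_add add: algebra_simps)
    then show ?thesis using True by (simp add: e_def powr_realpow)
  qed (auto simp: e_def indicator_def not_less)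
  \<comment> \<open>The binomial series: the sign in \<open>(- s) ^ n\<close> turns the generalized
    binomial coefficient of \<open>b - 1\<close> into \<open>c n\<close>.\<close>
  have c_sums: "(\<lambda>n. c n * s ^ n) sums (1 - s) powr (b - 1)" if "\<bar>s\<bar> < 1" for s
  proof -
    have "(\<lambda>n. ((b - 1) gchoose n) * (- s) ^ n) sums (1 + (- s)) powr (b - 1)"
      by (rule gen_binomial_real) (use that in auto)
    also have "(\<lambda>n. ((b - 1) gchoose n) * (- s) ^ n) = (\<lambda>n. c n * s ^ n)"
    proof
      fix n
      have "(- s) ^ n = (- 1) ^ n * s ^ n" by (rule power_minus)
      moreover have "(- 1) ^ n * (- 1) ^ n = (1::real)" by (simp flip: power_mult_distrib)
      ultimately show "((b - 1) gchoose n) * (- s) ^ n = c n * s ^ n"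
        by (simp add: gbinomial_pochhammer c_def)
    qed
    finally show ?thesis by simp
  qed
  have f_sums: "(\<lambda>n. f n t) sums e a b t" for t
  proof (cases "t \<in> {0<..<1}")
    case True
    have "(\<lambda>n. t powr (a - 1) * (c n * t ^ n)) sums (t powr (a - 1) * (1 - t) powr (b - 1))"
      using True by (intro sums_mult c_sums) auto
    moreover have "e a b t = t powr (a - 1) * (1 - t) powr (b - 1)"
      using True by (simp add: e_def)
    moreover have "f n t = t powr (a - 1) * (c n * t ^ n)" for n
      using True by (simp add: f_def e_powr)
    ultimately show ?thesis by simp
  next
    case False
    then have "e a b t = 0" by (auto simp: e_def indicator_def not_less)
    then show ?thesis using False by (simp add: f_def e_powr del: greaterThanLessThan_iff)
  qed
  have f_abs: "summable (\<lambda>n. norm (f n t))" for t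
  proof (cases "t \<in> {0<..<1}")
    case True
    \<comment> \<open>A power series convergent at \<open>s\<close> converges absolutely at every
      point of smaller modulus.\<close>
    then obtain s where "t < s" "s < 1" using dense by auto
    then have "summable (\<lambda>n. norm (c n * t ^ n))"
      using powser_insidea[OF sums_summable[OF c_sums], of s t] True by auto
    then have "summable (\<lambda>n. t powr (a - 1) * norm (c n * t ^ n))"
      by (rule summable_mult)
    then show ?thesis using True by (simp add: f_def e_powr abs_mult mult_ac)
  qed (simp add: f_def e_powr del: greaterThanLessThan_iff)
  \<comment> \<open>Sum and integral may be exchanged because the series of the L1 norms converges;
    these norms are the terms of \<open>summ_c\<close>.\<close>
  have "(\<lambda>n. \<integral>t. f n t \<partial>lborel) sums (\<integral>t. (\<Sum>n. f n t) \<partial>lborel)"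
  proof (rule sums_integral)
    show "integrable lborel (f n)" for n
      unfolding f_def[abs_def] using assms by (intro integrable_mult_right int_e) auto
    have "(\<integral>t. norm (f n t) \<partial>lborel) = \<bar>c n\<bar> / (a + real n)" for n
      using assms integral_e[of "a + real n" 1] e_nonneg Beta_1[of n] by (simp add: f_def abs_mult)
    then show "summable (\<lambda>n. \<integral>t. norm (f n t) \<partial>lborel)"
      using summ_c by simp
  qed (use f_abs in auto)
  moreover have "(\<integral>t. f n t \<partial>lborel) = pochhammer (1 - b) n / fact n / (a + real n)" for n
    using assms integral_e[of "a + real n" 1] Beta_1[of n] by (simp add: f_def c_def)
  moreover have "(\<integral>t. (\<Sum>n. f n t) \<partial>lborel) = Beta a b"
    using f_sums[THEN sums_unique] integral_e[OF assms] by simp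
  ultimately show ?thesis by simp
qed

section \<open>The central beta function\<close>

lemma wallis_pos: "0 < wallis n"
  by (simp add: wallis_def pochhammer_pos)

lemma wallis_sums:
  "0 < x \<Longrightarrow> (\<lambda>n. wallis n / (x + real n)) sums Beta x (1/2)"
  using Beta_sums[of x "1/2"] by (simp add: wallis_def)

text \<open>Extending the quotient by \<open>Gamma (x + 1/2)\<close> makes the duplication formula
  applicable. The factor \<open>sqrt pi\<close> it produces is \<open>Gamma (1/2)\<close>.\<close>

lemma central_beta_eq_Beta:
  assumes "0 < x"
  shows "central_beta x = 2 powr (1 - 2 * x) * Beta x (1/2)"
proof -
  have nonpos: "complex_of_real y \<notin> \<int>\<^sub>\<le>\<^sub>0" if "0 < y" for y
    using that by (auto elim!: nonpos_Ints_cases simp: complex_eq_iff)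
  have not_pole: "complex_of_real x \<notin> \<int>\<^sub>\<le>\<^sub>0" "complex_of_real x + 1/2 \<notin> \<int>\<^sub>\<le>\<^sub>0"
    using nonpos[of x] nonpos[of "x + 1/2"] assms by simp_all
  \<comment> \<open>The duplication formula is applied at a complex argument and read back through
    the injectivity of \<open>complex_of_real\<close>.\<close>
  have "complex_of_real (Gamma x * Gamma (x + 1/2)) =
      Gamma (complex_of_real x) * Gamma (complex_of_real x + 1/2)"
    by (simp flip: Gamma_complex_of_real)
  also have "\<dots> = exp ((1 - 2 * complex_of_real x) * of_real (ln 2)) * of_real (sqrt pi) *
      Gamma (2 * complex_of_real x)"
    by (rule Gamma_legendre_duplication[OF not_pole])
  also have "\<dots> = complex_of_real (exp ((1 - 2 * x) * ln 2) * sqrt pi * Gamma (2 * x))"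
    by (simp flip: Gamma_complex_of_real exp_of_real)
  finally have "complex_of_real (Gamma x * Gamma (x + 1/2)) =
      complex_of_real (exp ((1 - 2 * x) * ln 2) * sqrt pi * Gamma (2 * x))" .
  then have dup: "Gamma x * Gamma (x + 1/2) = 2 powr (1 - 2 * x) * sqrt pi * Gamma (2 * x)"
    by (simp only: of_real_eq_iff) (simp add: powr_def)
  have pos: "0 < Gamma (x + 1/2)" "0 < Gamma (2 * x)"
    using assms by (auto intro!: Gamma_real_pos)
  have "central_beta x = Gamma x * (Gamma x * Gamma (x + 1/2)) / (Gamma (2 * x) * Gamma (x + 1/2))"
    using pos by (simp add: central_beta_def power2_eq_square)
  also have "\<dots> = 2 powr (1 - 2 * x) * Beta x (1/2)"
    unfolding dup using pos by (simp add: Beta_def Gamma_one_half_real)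
  finally show ?thesis .
qed

text \<open>The functional equation, applied to \<open>Gamma (x + 1)\<close> and
  \<open>Gamma (2 * x + 1)\<close>, gives \<open>Beta (x + 1) x\<close> the factor
  \<open>x / (2 * x)\<close>, which is the one half in the limit.\<close>

lemma central_beta_pochhammer_sums:
  assumes "0 < x"
  shows "(\<lambda>n. pochhammer (1 - x) n / ((x + real n + 1) * fact n)) sums (central_beta x / 2)"
proof -
  have "x \<notin> \<int>\<^sub>\<le>\<^sub>0" "2 * x \<notin> \<int>\<^sub>\<le>\<^sub>0"
    using assms by (auto elim!: nonpos_Ints_cases)
  then have eq: "Beta (x + 1) x = central_beta x / 2"
    using Gamma_plus1[of x] Gamma_plus1[of "2 * x"] assms
    by (simp add: Beta_def central_beta_def power2_eq_square algebra_simps)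
  show ?thesis
    using Beta_sums[of "x + 1" x] assms unfolding eq [symmetric] by (simp add: mult_ac add_ac)
qed

section \<open>Complete monotonicity of the central beta function and of the remainders\<close>

text \<open>The factors \<open>1 + k - x\<close> are nonnegative and decreasing on the interval. The
  first of them, \<open>1 - x\<close>, is negative beyond 1, hence the restriction to
  \<open>{0<..<1}\<close>.\<close>

lemma completely_monotonic_on_pochhammer:
  "completely_monotonic_on {0<..<1} (\<lambda>x. pochhammer (1 - x) n)"
proof (induction n)
  case 0
  then show ?case using completely_monotonic_on_const[of 1] by simp
next
  case (Suc n)
  have "completely_monotonic_on {0<..<1} (\<lambda>x. pochhammer (1 - x) n * ((1 + real n) - x))"
    by (intro completely_monotonic_on_mult Suc completely_monotonic_on_minus) auto
  then show ?case by (simp add: pochhammer_Suc algebra_simps)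
qed

lemma completely_monotonic_on_wallis_term:
  "completely_monotonic_on {0<..} (\<lambda>x. wallis n / (x + real n))"
proof -
  have "completely_monotonic_on {0<..} (\<lambda>x. wallis n * (1 / (x + real n)))"
    using wallis_pos[of n]
    by (intro completely_monotonic_on_mult completely_monotonic_on_const
        completely_monotonic_on_inverse_shift) auto
  then show ?thesis by simp
qed

text \<open>The starting index is left free: 0 gives the function itself, \<open>Suc n\<close> the
  remainder after the terms up to \<open>n\<close>.\<close>

lemma completely_monotonic_on_wallis_tail:
  "completely_monotonic_on {0<..} (\<lambda>x. \<Sum>k. wallis (k + n) / (x + real (k + n)))"
proof (rule completely_monotonic_on_suminf[OF completely_monotonic_on_wallis_term])
  fix x :: real assume "x \<in> {0<..}"
  then show "summable (\<lambda>k. wallis (k + n) / (x + real (k + n)))"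
    using summable_ignore_initial_segment[OF sums_summable[OF wallis_sums]] by auto
qed auto

lemma completely_monotonic_on_central_beta: "completely_monotonic_on {0<..} central_beta"
proof -
  have "completely_monotonic_on {0<..}
      (\<lambda>x. 2 * exp (- (2 * ln 2) * x) * (\<Sum>k. wallis (k + 0) / (x + real (k + 0))))"
    by (intro completely_monotonic_on_mult completely_monotonic_on_const completely_monotonic_on_exp
        completely_monotonic_on_wallis_tail) auto
  moreover have "2 * exp (- (2 * ln 2) * x) * (\<Sum>k. wallis (k + 0) / (x + real (k + 0))) =
      central_beta x" if "x \<in> {0<..}" for x
  proof -
    have "2 powr (1 - 2 * x) = exp (ln 2 + (- (2 * ln 2) * x))"
      by (simp add: powr_def algebra_simps)
    also have "\<dots> = 2 * exp (- (2 * ln 2) * x)"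
      by (subst exp_add) simp
    finally show ?thesis
      using that by (simp add: central_beta_eq_Beta sums_unique[OF wallis_sums])
  qed
  ultimately show ?thesis
    by (subst (asm) completely_monotonic_on_cong) auto
qed

text \<open>The power of 2 cancels the prefactor of the first expansion, so the difference is the
  tail of that series from index \<open>Suc n\<close> on.\<close>

lemma completely_monotonic_on_wallis_remainder:
  "completely_monotonic_on {0<..}
     (\<lambda>x. 2 powr (2 * x - 1) * central_beta x - (\<Sum>k=0..n. wallis k / (x + real k)))"
proof -
  have "(\<Sum>k. wallis (k + Suc n) / (x + real (k + Suc n))) =
      2 powr (2 * x - 1) * central_beta x - (\<Sum>k=0..n. wallis k / (x + real k))"
    if "x \<in> {0<..}" for x
  proof -
    have "2 powr (2 * x - 1) * central_beta x = (2 powr (2 * x - 1) * 2 powr (1 - 2 * x)) * Beta x (1/2)"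
      using that by (simp add: central_beta_eq_Beta)
    also have "\<dots> = Beta x (1/2)"
      by (subst powr_add [symmetric]) simp
    also have "\<dots> = (\<Sum>k. wallis k / (x + real k))"
      using that by (simp add: sums_unique[OF wallis_sums])
    finally show ?thesis
      using suminf_minus_initial_segment[OF sums_summable[OF wallis_sums], of x "Suc n"] that
      by (simp add: atLeast0AtMost lessThan_Suc_atMost)
  qed
  with completely_monotonic_on_wallis_tail[of "Suc n"] show ?thesis
    by (subst (asm) completely_monotonic_on_cong) auto
qed

text \<open>The difference is twice a tail of the second expansion, whose terms are products of
  completely monotonic functions on \<open>{0<..<1}\<close>.\<close>

lemma completely_monotonic_on_pochhammer_remainder:
  "completely_monotonic_on {0<..<1}
     (\<lambda>x. central_beta x - 2 * (\<Sum>k=0..n. pochhammer (1 - x) k / ((x + real k + 1) * fact k)))"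
proof -
  define g where "g k x = pochhammer (1 - x) k / ((x + real k + 1) * fact k)" for k and x :: real
  have g_sums: "(\<lambda>k. g k x) sums (central_beta x / 2)" if "0 < x" for x
    unfolding g_def by (rule central_beta_pochhammer_sums[OF that])
  have cm_g: "completely_monotonic_on {0<..<1} (g k)" for k
  proof -
    have "completely_monotonic_on {0<..<1}
        (\<lambda>x. pochhammer (1 - x) k * (1 / (x + (real k + 1))) * (1 / fact k))"
      by (intro completely_monotonic_on_mult completely_monotonic_on_const
          completely_monotonic_on_pochhammer completely_monotonic_on_inverse_shift) auto
    then show ?thesis by (simp add: g_def[abs_def] add_ac)
  qed
  have "completely_monotonic_on {0<..<1} (\<lambda>x. \<Sum>k. g (k + Suc n) x)"
  proof (rule completely_monotonic_on_suminf[OF cm_g])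
    fix x :: real assume "x \<in> {0<..<1}"
    then show "summable (\<lambda>k. g (k + Suc n) x)"
      by (intro summable_ignore_initial_segment[OF sums_summable[OF g_sums]]) auto
  qed auto
  then have "completely_monotonic_on {0<..<1} (\<lambda>x. 2 * (\<Sum>k. g (k + Suc n) x))"
    by (intro completely_monotonic_on_mult completely_monotonic_on_const) auto
  moreover have "2 * (\<Sum>k. g (k + Suc n) x) = central_beta x - 2 * (\<Sum>k=0..n. g k x)"
    if "x \<in> {0<..<1}" for x
    using suminf_minus_initial_segment[OF sums_summable[OF g_sums], of x "Suc n"]
      sums_unique[OF g_sums, of x] that
    by (simp add: atLeast0AtMost lessThan_Suc_atMost algebra_simps)
  ultimately show ?thesis
    by (subst (asm) completely_monotonic_on_cong) (auto simp: g_def)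
qed

section \<open>The power series on the unit interval\<close>

text \<open>Comparison with the Wallis series at \<open>x = 1\<close>; the factor 2 comes from
  \<open>1 + n \<le> 2 * n\<close> for \<open>n \<ge> 1\<close>.\<close>

lemma summable_wallis_zeta:
  assumes "1 \<le> p"
  shows "summable (\<lambda>n. wallis (Suc n) / real (Suc n) ^ p)"
proof (rule summable_comparison_test')
  show "summable (\<lambda>n. 2 * (wallis (Suc n) / (1 + real (Suc n))))"
    using summable_ignore_initial_segment[OF sums_summable[OF wallis_sums[of 1]], of 1]
    by (intro summable_mult) simp
  fix n :: nat
  have "(1 + real (Suc n)) / 2 \<le> real (Suc n) ^ 1" by simp
  also have "\<dots> \<le> real (Suc n) ^ p"
    using assms by (intro power_increasing) auto
  finally have "wallis (Suc n) / real (Suc n) ^ p \<le> wallis (Suc n) / ((1 + real (Suc n)) / 2)"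
    using wallis_pos[of "Suc n"] by (intro divide_left_mono) auto
  then show "norm (wallis (Suc n) / real (Suc n) ^ p) \<le> 2 * (wallis (Suc n) / (1 + real (Suc n)))"
    using wallis_pos[of "Suc n"] by (simp add: mult.commute)
qed

text \<open>A finite geometric sum of ratio \<open>- x / y\<close>. The error against
  \<open>1 / (x + y)\<close> is kept exactly, to be summed later over all
  \<open>y = Suc n\<close>.\<close>

lemma sum_geometric_shift:
  fixes x y :: "'a::field"
  assumes "y \<noteq> 0" "x + y \<noteq> 0"
  shows "(\<Sum>j<J. (-1) ^ j / y ^ Suc j * x ^ j) = 1 / (x + y) - (- x / y) ^ J / (x + y)"
proof -
  define r where "r = - x / y"
  have r: "(r - 1) * y = - (x + y)" "r \<noteq> 1"
    using assms by (auto simp: r_def field_simps)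
  have "(\<Sum>j<J. (-1) ^ j / y ^ Suc j * x ^ j) = (\<Sum>j<J. r ^ j) / y"
    unfolding sum_divide_distrib
  proof (rule sum.cong[OF refl])
    fix j
    have "r ^ j = (-1) ^ j * x ^ j / y ^ j"
      by (simp only: r_def power_divide power_minus[of x])
    then show "(-1) ^ j / y ^ Suc j * x ^ j = r ^ j / y" by (simp add: mult_ac)
  qed
  also have "\<dots> = (r ^ J - 1) / ((r - 1) * y)"
    using geometric_sum[OF r(2), of J] by simp
  also have "\<dots> = 1 / (x + y) - r ^ J / (x + y)"
    unfolding r(1) divide_minus_right by (simp add: diff_divide_distrib)
  finally show ?thesis by (simp only: r_def)
qed

text \<open>Each \<open>1 / (x + n)\<close> with \<open>n \<ge> 1\<close> is expanded in powers of
  \<open>x\<close>. The term with \<open>n = 0\<close> is left out, being singular at the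
  origin.\<close>

lemma wallis_zeta_power_series:
  assumes x: "0 < x" "x < 1"
  shows "(\<lambda>j. (-1) ^ j * wallis_zeta (Suc j) * x ^ j) sums
    (\<Sum>n. wallis (Suc n) / (x + real (Suc n)))"
proof -
  define w where "w n = wallis (Suc n) / (x + real (Suc n))" for n
  have w_pos: "0 < w n" for n
    using x wallis_pos[of "Suc n"] by (simp add: w_def)
  have summ_w: "summable w"
    using summable_ignore_initial_segment[OF sums_summable[OF wallis_sums[OF x(1)]], of 1]
    by (simp add: w_def[abs_def])
  \<comment> \<open>As \<open>Suc n\<close> is at least 1, the ratio is at most \<open>x\<close> in
    modulus, uniformly in \<open>n\<close>.\<close>
  have ratio: "\<bar>w n * (- x / real (Suc n)) ^ J\<bar> \<le> x ^ J * w n" for n J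
  proof -
    have "\<bar>- x / real (Suc n)\<bar> \<le> x" using x by (simp add: divide_le_eq)
    then have "\<bar>- x / real (Suc n)\<bar> ^ J \<le> x ^ J" by (intro power_mono) auto
    then show ?thesis
      using w_pos[of n] by (simp add: abs_mult power_abs mult.commute)
  qed
  have summ_rem: "summable (\<lambda>n. w n * (- x / real (Suc n)) ^ J)" for J
    by (rule summable_comparison_test'[OF summable_mult[OF summ_w, of "x ^ J"]]) (use ratio in auto)
  \<comment> \<open>Only finitely many powers are exchanged with the sum over \<open>n\<close>, so
    no interchange of two infinite sums is involved.\<close>
  have partial: "(\<Sum>j<J. (-1) ^ j * wallis_zeta (Suc j) * x ^ j) =
      suminf w - (\<Sum>n. w n * (- x / real (Suc n)) ^ J)" for J
  proof -
    have "(\<Sum>j<J. (-1) ^ j * wallis_zeta (Suc j) * x ^ j) =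
        (\<Sum>j<J. \<Sum>n. (-1) ^ j * x ^ j * (wallis (Suc n) / real (Suc n) ^ Suc j))"
      unfolding wallis_zeta_def
      by (subst suminf_mult) (auto intro: summable_wallis_zeta simp: mult_ac simp del: power_Suc of_nat_Suc)
    also have "\<dots> = (\<Sum>n. \<Sum>j<J. (-1) ^ j * x ^ j * (wallis (Suc n) / real (Suc n) ^ Suc j))"
      by (rule suminf_sum [symmetric]) (intro summable_mult summable_wallis_zeta, simp)
    also have "\<dots> = (\<Sum>n. w n - w n * (- x / real (Suc n)) ^ J)"
    proof (rule suminf_cong)
      fix n
      have "(\<Sum>j<J. (-1) ^ j * x ^ j * (wallis (Suc n) / real (Suc n) ^ Suc j)) =
          wallis (Suc n) * (\<Sum>j<J. (-1) ^ j / real (Suc n) ^ Suc j * x ^ j)"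
        by (simp add: sum_distrib_left mult_ac del: power_Suc of_nat_Suc)
      also have "\<dots> = wallis (Suc n) * (1 / (x + real (Suc n)) - (- x / real (Suc n)) ^ J / (x + real (Suc n)))"
        using x by (subst sum_geometric_shift) auto
      also have "\<dots> = w n - w n * (- x / real (Suc n)) ^ J"
        by (simp add: w_def right_diff_distrib del: of_nat_Suc)
      finally show "(\<Sum>j<J. (-1) ^ j * x ^ j * (wallis (Suc n) / real (Suc n) ^ Suc j)) =
          w n - w n * (- x / real (Suc n)) ^ J" .
    qed
    also have "\<dots> = suminf w - (\<Sum>n. w n * (- x / real (Suc n)) ^ J)"
      by (rule suminf_diff [OF summ_w summ_rem, symmetric])
    finally show ?thesis .
  qed
  have "\<bar>\<Sum>n. w n * (- x / real (Suc n)) ^ J\<bar> \<le> x ^ J * suminf w" for J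
  proof -
    have summ_abs: "summable (\<lambda>n. \<bar>w n * (- x / real (Suc n)) ^ J\<bar>)"
      by (rule summable_comparison_test'[OF summable_mult[OF summ_w, of "x ^ J"]]) (use ratio in auto)
    have "\<bar>\<Sum>n. w n * (- x / real (Suc n)) ^ J\<bar> \<le> (\<Sum>n. \<bar>w n * (- x / real (Suc n)) ^ J\<bar>)"
      by (rule summable_rabs[OF summ_abs])
    also have "\<dots> \<le> (\<Sum>n. x ^ J * w n)"
      by (rule suminf_le[OF ratio summ_abs summable_mult[OF summ_w]])
    also have "\<dots> = x ^ J * suminf w"
      by (rule suminf_mult[OF summ_w])
    finally show ?thesis .
  qed
  then have "\<forall>\<^sub>F J in sequentially. norm (\<Sum>n. w n * (- x / real (Suc n)) ^ J) \<le> x ^ J * suminf w"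
    unfolding real_norm_def by (intro always_eventually allI)
  moreover have "(\<lambda>J. x ^ J * suminf w) \<longlonglongrightarrow> 0"
    using x by (intro tendsto_mult_left_zero LIMSEQ_power_zero) auto
  ultimately have "(\<lambda>J. \<Sum>n. w n * (- x / real (Suc n)) ^ J) \<longlonglongrightarrow> 0"
    by (rule Lim_null_comparison)
  then have "(\<lambda>J. suminf w - (\<Sum>n. w n * (- x / real (Suc n)) ^ J)) \<longlonglongrightarrow> suminf w - 0"
    by (intro tendsto_diff tendsto_const)
  then have "(\<lambda>J. \<Sum>j<J. (-1) ^ j * wallis_zeta (Suc j) * x ^ j) \<longlonglongrightarrow> suminf w"
    unfolding partial by simp
  then show ?thesis
    unfolding sums_def w_def[abs_def] .
qed

text \<open>The Cauchy product of the series of \<open>exp (- x * ln 4)\<close> with that of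
  \<open>x * (\<Sum>n. wallis n / (x + n))\<close>.\<close>
lemma central_beta_coeff_sums:
  assumes x: "0 < x" "x < 1"
  shows "(\<lambda>k. central_beta_coeff k * x ^ k) sums (x * central_beta x / 2)"
proof -
  define T where "T = (\<Sum>n. wallis (Suc n) / (x + real (Suc n)))"
  define a where "a k = (- x * ln 4) ^ k / fact k" for k
  \<comment> \<open>The term of degree \<open>p\<close> of \<open>1 + x * T\<close>. The 1 is
    \<open>x\<close> times the Wallis term of index 0; the minus sign comes from the shift
    \<open>p = Suc j\<close>.\<close>
  define b where "b p = (if p = 0 then 1 else - ((-1) ^ p * wallis_zeta p * x ^ p))" for p
  have a_sums: "a sums exp (- x * ln 4)"
    using exp_converges[of "- x * ln 4"] by (simp add: a_def[abs_def] divide_inverse mult_ac)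
  have a_abs: "summable (\<lambda>k. norm (a k))"
    using summable_norm_exp[of "- x * ln 4"]
    by (simp add: a_def[abs_def] divide_inverse abs_mult mult_ac)
  \<comment> \<open>Convergence at \<open>y\<close> yields the absolute convergence at
    \<open>x\<close> that the Cauchy product asks for.\<close>
  obtain y where y: "x < y" "y < 1" using dense x by blast
  have "summable (\<lambda>j. norm ((-1) ^ j * wallis_zeta (Suc j) * x ^ j))"
    by (rule powser_insidea[OF sums_summable[OF wallis_zeta_power_series[of y]]]) (use x y in auto)
  then have "summable (\<lambda>j. x * norm ((-1) ^ j * wallis_zeta (Suc j) * x ^ j))"
    by (rule summable_mult)
  also have "(\<lambda>j. x * norm ((-1) ^ j * wallis_zeta (Suc j) * x ^ j)) = (\<lambda>j. norm (b (Suc j)))"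
    using x by (simp add: b_def abs_mult power_abs mult_ac fun_eq_iff)
  finally have b_abs: "summable (\<lambda>p. norm (b p))"
    by (subst (asm) summable_Suc_iff)
  have "(\<lambda>j. x * ((-1) ^ j * wallis_zeta (Suc j) * x ^ j)) sums (x * T)"
    unfolding T_def by (intro sums_mult wallis_zeta_power_series x)
  then have "(\<lambda>j. b (Suc j)) sums (x * T)"
    by (simp add: b_def mult_ac)
  then have b_sums: "b sums (1 + x * T)"
    by (subst (asm) sums_Suc_iff) (simp add: b_def add.commute)
  have coeff: "(\<Sum>i\<le>k. a i * b (k - i)) = central_beta_coeff k * x ^ k" for k
  proof -
    \<comment> \<open>Since \<open>b 0 = 1\<close>, the last summand of the convolution is
      \<open>a k\<close>, the source of the isolated term \<open>ln 4 ^ k / fact k\<close> of the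
      coefficient.\<close>
    have "(\<Sum>i\<le>k. a i * b (k - i)) = a k + (\<Sum>i<k. a i * b (k - i))"
      by (simp add: b_def flip: lessThan_Suc_atMost)
    also have "(\<Sum>i<k. a i * b (k - i)) =
        (\<Sum>i<k. - ((-1) ^ k * x ^ k * (wallis_zeta (k - i) * (ln 4 ^ i / fact i))))"
    proof (rule sum.cong[OF refl])
      fix i assume "i \<in> {..<k}"
      then have i: "i < k" by simp
      have pow: "z ^ i * z ^ (k - i) = z ^ k" for z :: real
        using i by (simp flip: power_add)
      have "a i = (-1) ^ i * x ^ i * ln 4 ^ i / fact i"
        by (simp add: a_def power_mult_distrib power_minus[of "x * ln 4"])
      then have "a i * b (k - i) = - (((-1) ^ i * (-1) ^ (k - i)) * (x ^ i * x ^ (k - i)) *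
          (wallis_zeta (k - i) * (ln 4 ^ i / fact i)))"
        using i by (simp add: b_def mult_ac)
      then show "a i * b (k - i) =
          - ((-1) ^ k * x ^ k * (wallis_zeta (k - i) * (ln 4 ^ i / fact i)))"
        unfolding pow .
    qed
    also have "\<dots> = - ((-1) ^ k * x ^ k * (\<Sum>i<k. wallis_zeta (k - i) * (ln 4 ^ i / fact i)))"
      by (simp add: sum_negf sum_distrib_left)
    also have "a k = (-1) ^ k * x ^ k * (ln 4 ^ k / fact k)"
      by (simp add: a_def power_mult_distrib power_minus[of "x * ln 4"])
    finally show ?thesis
      by (cases "k = 0") (simp_all add: central_beta_coeff_def algebra_simps)
  qed
  have "(\<lambda>k. central_beta_coeff k * x ^ k) sums (exp (- x * ln 4) * (1 + x * T))"
    using Cauchy_product_sums[OF a_abs b_abs] sums_unique[OF a_sums] sums_unique[OF b_sums]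
    by (simp add: coeff)
  also have "exp (- x * ln 4) * (1 + x * T) = x * central_beta x / 2"
  proof -
    have "ln 4 = 2 * ln (2::real)"
      using ln_realpow[of 2 2] by simp
    then have "2 powr (1 - 2 * x) = exp (ln 2 + (- x * ln 4))"
      by (simp add: powr_def algebra_simps)
    also have "\<dots> = 2 * exp (- x * ln 4)"
      by (subst exp_add) simp
    finally have e: "2 powr (1 - 2 * x) = 2 * exp (- x * ln 4)" .
    have "Beta x (1/2) = 1 / x + T"
      using suminf_split_head[OF sums_summable[OF wallis_sums[OF x(1)]]]
        sums_unique[OF wallis_sums[OF x(1)]] by (simp add: T_def wallis_def)
    then have "x * Beta x (1/2) = 1 + x * T"
      using x by (simp add: distrib_left)
    then show ?thesis
      unfolding central_beta_eq_Beta[OF x(1)] e by simp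
  qed
  finally show ?thesis .
qed

text \<open>As \<open>suminf\<close> has a value for divergent series too, convergence is asserted
  beside each expansion, and likewise for the series behind \<open>wallis_zeta\<close>.\<close>

theorem theorem2:
  shows
    "(\<forall>x::real. x > 0 \<longrightarrow>
       summable (\<lambda>n. wallis n / (x + real n)) \<and>
       central_beta x = 2 powr (1 - 2 * x) * (\<Sum>n. wallis n / (x + real n)) \<and>
       summable (\<lambda>n. pochhammer (1 - x) n / ((x + real n + 1) * fact n)) \<and>
       central_beta x = 2 * (\<Sum>n. pochhammer (1 - x) n / ((x + real n + 1) * fact n))) \<and>
     (completely_monotonic_on {0<..} central_beta) \<and>
     (\<forall>n::nat. completely_monotonic_on {0<..}
           (\<lambda>x. 2 powr (2 * x - 1) * central_beta x - (\<Sum>k=0..n. wallis k / (x + real k)))) \<and>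
     (\<forall>n::nat. completely_monotonic_on {0<..<1}
           (\<lambda>x. central_beta x
                - 2 * (\<Sum>k=0..n. pochhammer (1 - x) k / ((x + real k + 1) * fact k)))) \<and>
     (\<forall>p\<ge>1. summable (\<lambda>n. wallis (Suc n) / real (Suc n) ^ p)) \<and>
     (\<forall>x::real. 0 < x \<and> x < 1 \<longrightarrow>
       summable (\<lambda>k. central_beta_coeff k * x ^ k) \<and>
       central_beta x = 2 / x * (\<Sum>k. central_beta_coeff k * x ^ k))"
proof (intro conjI allI impI)
  fix x :: real assume x: "0 < x"
  show "summable (\<lambda>n. wallis n / (x + real n))"
    by (rule sums_summable[OF wallis_sums[OF x]])
  show "central_beta x = 2 powr (1 - 2 * x) * (\<Sum>n. wallis n / (x + real n))"
    by (simp add: central_beta_eq_Beta[OF x] sums_unique[OF wallis_sums[OF x]])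
  show "summable (\<lambda>n. pochhammer (1 - x) n / ((x + real n + 1) * fact n))"
    by (rule sums_summable[OF central_beta_pochhammer_sums[OF x]])
  show "central_beta x = 2 * (\<Sum>n. pochhammer (1 - x) n / ((x + real n + 1) * fact n))"
    by (simp add: sums_unique[OF central_beta_pochhammer_sums[OF x], symmetric])
next
  fix x :: real assume "0 < x \<and> x < 1"
  then have x: "0 < x" and S: "(\<lambda>k. central_beta_coeff k * x ^ k) sums (x * central_beta x / 2)"
    using central_beta_coeff_sums by auto
  show "summable (\<lambda>k. central_beta_coeff k * x ^ k)"
    by (rule sums_summable[OF S])
  show "central_beta x = 2 / x * (\<Sum>k. central_beta_coeff k * x ^ k)"
    using x by (simp add: sums_unique[OF S, symmetric])
qed (use completely_monotonic_on_central_beta completely_monotonic_on_wallis_remainder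
    completely_monotonic_on_pochhammer_remainder summable_wallis_zeta in auto)

end
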